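(* For every choice of parameters $0<\alpha,\beta<1$, the competitive ratio of algorithm FIFOQueEH (even on decremental FIFO queues) is at least $1.8$.
   Context: Dynamic set problem: each item $x$ has a weight $w_x\ge 0$; time proceeds in steps; before each step items may be inserted into or deleted from a dynamic set $\mathcal{S}$; an item is active if inserted and not yet deleted; at each step an algorithm may collect at most one active item it has not collected before (pending items); the gain is the total weight collected. A deterministic online algorithm is $R$-competitive if on every instance its gain is at least $\mathrm{OPT}/R$; its competitive ratio is the infimum of such $R$. Dynamic queue: $\mathcal{S}$ is a linearly ordered list; only a prefix of the current list may be deleted; FIFO: insertions only at the end; decremental: all items inserted before the first step. Algorithm FIFOQueEH with parameters $0<\alpha,\beta<1$: it maintains a reference item $h'$ (initially an imaginary item of weight $0$ that is never pending). At each step let $h$ be the heaviest pending item. If $h'$ is not pending, or $h'$ is pending and $\alpha w_h\ge w_{h'}$, then collect the earliest (in queue order) pending item $e$ with $w_e\ge\beta w_h$, and $h$ becomes the new reference item $h'$; otherwise collect $h'$. *)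

theory Defs
  imports Complex_Main "HOL-Library.Extended_Real"
begin

text \<open>
  An input has finitely many steps, hence finitely many items, so naming the items by natural
  numbers loses no generality.  The entry \<open>queues I ! t\<close> is the list of the items that are
  active during step \<open>t\<close>, earliest first, after all insertions and deletions preceding that step.
\<close>

type_synonym item = nat

record queue_input =
  weight :: "item \<Rightarrow> real"
  queues :: "item list list"

definition steps :: "queue_input \<Rightarrow> nat" where
  "steps I = length (queues I)"

definition queue_at :: "queue_input \<Rightarrow> nat \<Rightarrow> item list" where
  "queue_at I t = queues I ! t"

text \<open>
  Between consecutive steps a prefix of length \<open>k\<close> is deleted and the items \<open>ys\<close> are appended.
  Inserted items are required to be new: an item that has been deleted never returns.
\<close>

definition fifo_queue :: "queue_input \<Rightarrow> bool" where
  "fifo_queue I \<longleftrightarrow>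
     (\<forall>x. 0 \<le> weight I x) \<and>
     (\<forall>t < steps I. distinct (queue_at I t)) \<and>
     (\<forall>t. Suc t < steps I \<longrightarrow>
        (\<exists>k ys. queue_at I (Suc t) = drop k (queue_at I t) @ ys \<and>
                (\<forall>s \<le> t. set ys \<inter> set (queue_at I s) = {})))"

definition decremental :: "queue_input \<Rightarrow> bool" where
  "decremental I \<longleftrightarrow> (\<forall>t < steps I. set (queue_at I t) \<subseteq> set (queue_at I 0))"

text \<open>A schedule says which item, if any, is collected in each step; only its values at the
  steps of the input matter.\<close>

type_synonym schedule = "nat \<Rightarrow> item option"

definition feasible :: "queue_input \<Rightarrow> schedule \<Rightarrow> bool" where
  "feasible I c \<longleftrightarrow>
     (\<forall>t < steps I. \<forall>x. c t = Some x \<longrightarrow>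
        x \<in> set (queue_at I t) \<and> (\<forall>s < t. c s \<noteq> Some x))"

definition gain :: "queue_input \<Rightarrow> schedule \<Rightarrow> real" where
  "gain I c = (\<Sum>t < steps I. case c t of None \<Rightarrow> 0 | Some x \<Rightarrow> weight I x)"

definition opt :: "queue_input \<Rightarrow> real" where
  "opt I = (SUP c \<in> {c. feasible I c}. gain I c)"

definition competitive ::
    "queue_input set \<Rightarrow> (queue_input \<Rightarrow> schedule) \<Rightarrow> real \<Rightarrow> bool" where
  "competitive \<I> A R \<longleftrightarrow> 0 < R \<and> (\<forall>I \<in> \<I>. opt I / R \<le> gain I (A I))"

text \<open>The infimum is taken in the extended reals, so that it is \<open>\<infinity>\<close> if no \<open>R\<close> qualifies.\<close>

definition competitive_ratio ::
    "queue_input set \<Rightarrow> (queue_input \<Rightarrow> schedule) \<Rightarrow> ereal" where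
  "competitive_ratio \<I> A = (INF R \<in> {R. competitive \<I> A R}. ereal R)"

definition pending :: "item list \<Rightarrow> item set \<Rightarrow> item list" where
  "pending q C = filter (\<lambda>x. x \<notin> C) q"

definition heaviest :: "(item \<Rightarrow> real) \<Rightarrow> item list \<Rightarrow> item list" where
  "heaviest w P = filter (\<lambda>x. \<forall>y \<in> set P. w y \<le> w x) P"

text \<open>
  If several pending items have maximum weight, a tie-breaking rule decides which of them is
  ``the'' heaviest one; it is given these items in queue order.
\<close>

definition tie_breaking :: "(item list \<Rightarrow> item) \<Rightarrow> bool" where
  "tie_breaking tb \<longleftrightarrow> (\<forall>xs. xs \<noteq> [] \<longrightarrow> tb xs \<in> set xs)"

text \<open>
  One step of the algorithm on queue \<open>q\<close>, when \<open>C\<close> is the set of items collected so far and \<open>r\<close>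
  is the reference item; \<open>None\<close> stands for the imaginary initial reference item, which is never
  pending.  The result is the item collected and the new reference item.
\<close>

definition eh_step ::
    "real \<Rightarrow> real \<Rightarrow> (item list \<Rightarrow> item) \<Rightarrow> (item \<Rightarrow> real) \<Rightarrow> item list \<Rightarrow>
       item set \<times> item option \<Rightarrow> item option \<times> item option" where
  "eh_step \<alpha> \<beta> tb w q = (\<lambda>(C, r).
     let P = pending q C in
     if P = [] then (None, r)
     else
       let h = tb (heaviest w P);
           e = hd (filter (\<lambda>x. \<beta> * w h \<le> w x) P)
       in case r of
            None \<Rightarrow> (Some e, Some h)
          | Some h' \<Rightarrow>
              if h' \<notin> set P \<or> w h' \<le> \<alpha> * w h then (Some e, Some h)
              else (Some h', Some h'))"

primrec eh_state ::
    "real \<Rightarrow> real \<Rightarrow> (item list \<Rightarrow> item) \<Rightarrow> queue_input \<Rightarrow> nat \<Rightarrow>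
       item set \<times> item option" where
  "eh_state \<alpha> \<beta> tb I 0 = ({}, None)"
| "eh_state \<alpha> \<beta> tb I (Suc t) =
     (let (c, r) = eh_step \<alpha> \<beta> tb (weight I) (queue_at I t) (eh_state \<alpha> \<beta> tb I t)
      in (fst (eh_state \<alpha> \<beta> tb I t) \<union> set_option c, r))"

definition FIFOQueEH ::
    "real \<Rightarrow> real \<Rightarrow> (item list \<Rightarrow> item) \<Rightarrow> queue_input \<Rightarrow> schedule" where
  "FIFOQueEH \<alpha> \<beta> tb I t =
     fst (eh_step \<alpha> \<beta> tb (weight I) (queue_at I t) (eh_state \<alpha> \<beta> tb I t))"

end

theory Submission imports Defs begin

text \<open>
  Two four-item inputs suffice.  On a decremental queue \<open>\<alpha>\<close> plays no role: a pending reference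
  item is still a heaviest one, so it is collected.  In both inputs below the algorithm
  collects an item of weight \<open>\<beta>\<close>, then the item of weight \<open>1\<close>, then nothing.

  If \<open>\<beta> \<ge> 2/3\<close>, the queue has weights \<open>b, b, \<beta>, 1\<close> with \<open>b\<close> just below \<open>\<beta>\<close> and loses one item per
  step; the optimum collects everything, for a ratio tending to \<open>(3\<beta> + 1) / (\<beta> + 1)\<close>.
  If \<open>\<beta> \<le> 2/3\<close>, the weights are \<open>\<beta>, b, b, 1\<close> with \<open>b\<close> just below \<open>1\<close>, and the optimum collects all
  items but the first within three steps, for a ratio tending to \<open>3 / (\<beta> + 1)\<close>.
  Both limits are at least \<open>9/5\<close> in their range.
\<close>

text \<open>A supremum of reals is known to bound its members only once the set is bounded above;
  here the total weight of all queues bounds every feasible gain.\<close>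

lemma gain_le_opt:
  assumes nonneg: "\<And>x. 0 \<le> weight I x" and c: "feasible I c"
  shows "gain I c \<le> opt I"
proof -
  have "gain I d \<le> (\<Sum>t<steps I. sum_list (map (weight I) (queue_at I t)))"
    if d: "feasible I d" for d
    unfolding gain_def
  proof (rule sum_mono)
    fix t assume "t \<in> {..<steps I}"
    then have "x \<in> set (queue_at I t)" if "d t = Some x" for x
      using d that by (auto simp: feasible_def)
    then show "(case d t of None \<Rightarrow> 0 | Some x \<Rightarrow> weight I x)
        \<le> sum_list (map (weight I) (queue_at I t))"
      using nonneg by (auto split: option.split intro!: sum_list_nonneg member_le_sum_list)
  qed
  then have "bdd_above (gain I ` {c. feasible I c})"
    by (intro bdd_aboveI2) auto
  then show ?thesis
    using c unfolding opt_def by (auto intro: cSUP_upper)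
qed

lemma competitive_gain_le:
  assumes "competitive \<I> A R" and "I \<in> \<I>" and "\<And>x. 0 \<le> weight I x" and "feasible I c"
  shows "gain I c \<le> R * gain I (A I)"
proof -
  have "0 < R" and "opt I / R \<le> gain I (A I)"
    using assms(1,2) by (auto simp: competitive_def)
  then have "opt I \<le> R * gain I (A I)"
    by (simp add: divide_le_eq mult.commute)
  with gain_le_opt[OF assms(3,4)] show ?thesis by linarith
qed

text \<open>More inputs leave fewer admissible \<open>R\<close>; this carries the bound from
  decremental to all FIFO queues.\<close>

lemma competitive_ratio_mono:
  assumes "\<I> \<subseteq> \<J>"
  shows "competitive_ratio \<I> A \<le> competitive_ratio \<J> A"
  using assms unfolding competitive_ratio_def competitive_def
  by (intro INF_superset_mono) auto

text \<open>With \<open>b\<close> and \<open>\<beta>\<close> below 1, item 3 alone is heaviest in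
  both inputs until it is collected, so ties never arise.\<close>

lemma tie_breaking_singleton: "tie_breaking tb \<Longrightarrow> tb [x] = x"
  by (force simp: tie_breaking_def)

definition large_threshold_input :: "real \<Rightarrow> real \<Rightarrow> queue_input" where
  "large_threshold_input \<beta> b =
     \<lparr>weight = (\<lambda>x. if x < 2 then b else if x = 2 then \<beta> else 1),
      queues = [[0, 1, 2, 3], [1, 2, 3], [2, 3], [3]]\<rparr>"

definition small_threshold_input :: "real \<Rightarrow> real \<Rightarrow> queue_input" where
  "small_threshold_input \<beta> b =
     \<lparr>weight = (\<lambda>x. if x = 0 then \<beta> else if x < 3 then b else 1),
      queues = [[0, 1, 2, 3], [2, 3], [3]]\<rparr>"

lemma fifo_decremental_large_threshold_input:
  assumes "0 \<le> b" "0 \<le> \<beta>"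
  shows "fifo_queue (large_threshold_input \<beta> b) \<and> decremental (large_threshold_input \<beta> b)"
  using assms
  by (auto simp: fifo_queue_def decremental_def large_threshold_input_def steps_def queue_at_def
      less_Suc_eq numeral_eq_Suc intro!: exI[of _ "Suc 0"])

lemma fifo_decremental_small_threshold_input:
  assumes "0 \<le> b" "0 \<le> \<beta>"
  shows "fifo_queue (small_threshold_input \<beta> b) \<and> decremental (small_threshold_input \<beta> b)"
proof -
  let ?I = "small_threshold_input \<beta> b"
  \<comment> \<open>Two items leave after the first step, one after the second.\<close>
  have "queue_at ?I (Suc t) = drop (2 - t) (queue_at ?I t)" if "Suc t < steps ?I" for t
    using that by (auto simp: small_threshold_input_def steps_def queue_at_def less_Suc_eq
        numeral_eq_Suc)
  then have "\<exists>k ys. queue_at ?I (Suc t) = drop k (queue_at ?I t) @ ys \<and>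
      (\<forall>s\<le>t. set ys \<inter> set (queue_at ?I s) = {})" if "Suc t < steps ?I" for t
    using that by (intro exI[of _ "2 - t"] exI[of _ "[]"]) simp
  then show ?thesis
    using assms unfolding fifo_queue_def
    by (auto simp: decremental_def small_threshold_input_def steps_def queue_at_def
        less_Suc_eq numeral_eq_Suc)
qed

text \<open>Items 0 and 1 miss the threshold \<open>\<beta>\<close>, so item 2 goes first;
  \<open>\<alpha> < 1\<close> keeps item 3 as reference for the next step, after which items 0 and 1
  are gone.\<close>

lemma gain_large_threshold_input:
  assumes "0 \<le> b" "b < \<beta>" "\<beta> < 1" "\<alpha> < 1" "tie_breaking tb"
  shows "gain (large_threshold_input \<beta> b) (FIFOQueEH \<alpha> \<beta> tb (large_threshold_input \<beta> b)) = \<beta> + 1"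
  using assms
  by (simp add: gain_def steps_def queue_at_def FIFOQueEH_def eh_step_def pending_def
      heaviest_def large_threshold_input_def tie_breaking_singleton numeral_eq_Suc)

text \<open>Item 0 meets the threshold with equality; taking it loses item 1, and taking the
  reference item 3 next loses item 2.\<close>

lemma gain_small_threshold_input:
  assumes "0 < \<beta>" "\<beta> < b" "b < 1" "\<alpha> < 1" "tie_breaking tb"
  shows "gain (small_threshold_input \<beta> b) (FIFOQueEH \<alpha> \<beta> tb (small_threshold_input \<beta> b)) = \<beta> + 1"
  using assms
  by (simp add: gain_def steps_def queue_at_def FIFOQueEH_def eh_step_def pending_def
      heaviest_def small_threshold_input_def tie_breaking_singleton numeral_eq_Suc)

lemma competitive_large_threshold:
  assumes comp: "competitive {I. fifo_queue I \<and> decremental I} (FIFOQueEH \<alpha> \<beta> tb) R"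
    and "\<alpha> < 1" "0 < \<beta>" "\<beta> < 1" "tie_breaking tb"
  shows "3 * \<beta> + 1 \<le> R * (\<beta> + 1)"
proof -
  \<comment> \<open>The bound is solved for \<open>b\<close> so that density of the reals yields the
    limit \<open>b = \<beta>\<close>.\<close>
  have "b \<le> (R * (\<beta> + 1) - \<beta> - 1) / 2" if b: "0 < b" "b < \<beta>" for b
  proof -
    let ?I = "large_threshold_input \<beta> b"
    have "feasible ?I Some"
      by (auto simp: feasible_def large_threshold_input_def steps_def queue_at_def
          less_Suc_eq numeral_eq_Suc)
    moreover have "gain ?I Some = 2 * b + \<beta> + 1"
      by (simp add: gain_def large_threshold_input_def steps_def numeral_eq_Suc)
    ultimately have "2 * b + \<beta> + 1 \<le> R * (\<beta> + 1)"
      using competitive_gain_le[OF comp, of ?I Some] gain_large_threshold_input[of b \<beta> \<alpha> tb]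
        fifo_decremental_large_threshold_input[of b \<beta>] b assms
      by (simp add: fifo_queue_def)
    then show ?thesis by simp
  qed
  then have "\<beta> \<le> (R * (\<beta> + 1) - \<beta> - 1) / 2"
    using \<open>0 < \<beta>\<close> by (rule dense_le_bounded[rotated])
  then show ?thesis by simp
qed

lemma competitive_small_threshold:
  assumes comp: "competitive {I. fifo_queue I \<and> decremental I} (FIFOQueEH \<alpha> \<beta> tb) R"
    and "\<alpha> < 1" "0 < \<beta>" "\<beta> < 1" "tie_breaking tb"
  shows "3 \<le> R * (\<beta> + 1)"
proof -
  have "b \<le> (R * (\<beta> + 1) - 1) / 2" if b: "\<beta> < b" "b < 1" for b
  proof -
    \<comment> \<open>Items 1, 2 and 3 are each collected in the last step in which they are
      active.\<close>
    let ?I = "small_threshold_input \<beta> b" and ?c = "\<lambda>t. Some (Suc t)"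
    have "feasible ?I ?c"
      by (auto simp: feasible_def small_threshold_input_def steps_def queue_at_def
          less_Suc_eq numeral_eq_Suc)
    moreover have "gain ?I ?c = 2 * b + 1"
      by (simp add: gain_def small_threshold_input_def steps_def numeral_eq_Suc)
    ultimately have "2 * b + 1 \<le> R * (\<beta> + 1)"
      using competitive_gain_le[OF comp, of ?I ?c] gain_small_threshold_input[of \<beta> b \<alpha> tb]
        fifo_decremental_small_threshold_input[of b \<beta>] b assms
      by (simp add: fifo_queue_def)
    then show ?thesis by simp
  qed
  then have "1 \<le> (R * (\<beta> + 1) - 1) / 2"
    using \<open>\<beta> < 1\<close> by (rule dense_le_bounded[rotated])
  then show ?thesis by simp
qed

theorem theorem7:
  fixes \<alpha> \<beta> :: real and tb :: "item list \<Rightarrow> item"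
  assumes "0 < \<alpha>" and "\<alpha> < 1" and "0 < \<beta>" and "\<beta> < 1"
    and "tie_breaking tb"
  shows "ereal 1.8 \<le> competitive_ratio {I. fifo_queue I} (FIFOQueEH \<alpha> \<beta> tb) \<and>
         ereal 1.8 \<le> competitive_ratio {I. fifo_queue I \<and> decremental I} (FIFOQueEH \<alpha> \<beta> tb)"
proof -
  let ?D = "{I. fifo_queue I \<and> decremental I}" and ?A = "FIFOQueEH \<alpha> \<beta> tb"
  have "1.8 \<le> R" if R: "competitive ?D ?A R" for R
  proof -
    \<comment> \<open>No case split on \<open>\<beta>\<close> is made: 3/5 of the first bound plus
      2/5 of the second is exactly this one.\<close>
    have "1.8 * (\<beta> + 1) \<le> R * (\<beta> + 1)"
      using competitive_large_threshold[OF R assms(2-5)]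
        competitive_small_threshold[OF R assms(2-5)]
      by (simp add: field_simps)
    then show ?thesis
      using \<open>0 < \<beta>\<close> by (intro mult_right_le_imp_le[of "1.8" "\<beta> + 1" R]) auto
  qed
  then have "ereal 1.8 \<le> competitive_ratio ?D ?A"
    unfolding competitive_ratio_def by (auto intro!: INF_greatest)
  moreover have "competitive_ratio ?D ?A \<le> competitive_ratio {I. fifo_queue I} ?A"
    by (rule competitive_ratio_mono) auto
  ultimately show ?thesis by (auto intro: order_trans)
qed

end
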